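(* Let $-1<a<1$. For every $x,y\in\mathbb R^n$ with $x\neq y$, every $t>0$ and every $z>0$, one has $$\partial_tP^{(a)}_z(x,y,t)-\mathscr B_aP^{(a)}_z(x,y,t)=\mathscr L_xP^{(a)}_z(x,y,t).$$
   Context: Let $n\ge3$ and let $\mathscr X=\{X_1,\dots,X_m\}$ be $C^\infty$ vector fields on $\mathbb R^n$ satisfying Hörmander's finite rank condition $\operatorname{rank}\operatorname{Lie}[X_1,\dots,X_m](x)=n$ at every $x\in\mathbb R^n$, with sub-Laplacean $\mathscr L=-\sum_{i=1}^mX_i^\star X_i$ ($X_i^\star$ the formal adjoint). It is assumed that outside a large compact set $\mathscr L$ coincides with the standard Laplacian. Then the heat operator $\mathscr H=\partial_t-\mathscr L$ admits a positive fundamental solution $p(x,t;\xi,\tau)=p(x,\xi;t-\tau)$, smooth in $\mathbb R^{n+1}\setminus\{(\xi,\tau)\}$, with $\partial_tp-\mathscr L_xp=0$ away from the singularity; write $p(x,y,t)$ for it with $\tau=0$. A subscript $x$ on $\mathscr L$ means that it acts in the variable $x$. $\mathscr B_a=\frac{\partial^2}{\partial z^2}+\frac az\frac{\partial}{\partial z}$ is the Bessel operator on $\{z>0\}$. The parabolic Poisson kernel is, for $x,y\in\mathbb R^n$, $z,t>0$, $$P^{(a)}_z(x,y,t)=\frac1{2^{1-a}\Gamma(\frac{1-a}2)}\frac{z^{1-a}}{t^{\frac{3-a}2}}e^{-\frac{z^2}{4t}}\,p(x,y,t),$$ where $\Gamma(\cdot)$ is Euler's gamma function. *)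

theory Defs
  imports "HOL-Analysis.Analysis"
begin

text \<open>Functions of class \<open>C\<^sup>k\<close> and \<open>C\<^sup>\<infinity>\<close>; meant for open sets \<open>S\<close> of a finite-dimensional space.\<close>

primrec Ck_on :: "nat \<Rightarrow> 'a::euclidean_space set \<Rightarrow> ('a \<Rightarrow> 'b::real_normed_vector) \<Rightarrow> bool" where
  "Ck_on 0 S f \<longleftrightarrow> continuous_on S f"
| "Ck_on (Suc k) S f \<longleftrightarrow>
     (\<forall>x\<in>S. f differentiable (at x)) \<and>
     (\<forall>v. Ck_on k S (\<lambda>x. frechet_derivative f (at x) v))"

definition smooth_on :: "'a::euclidean_space set \<Rightarrow> ('a \<Rightarrow> 'b::real_normed_vector) \<Rightarrow> bool" where
  "smooth_on S f \<longleftrightarrow> (\<forall>k. Ck_on k S f)"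

definition partial :: "'n::finite \<Rightarrow> (real^'n \<Rightarrow> real) \<Rightarrow> real^'n \<Rightarrow> real" where
  "partial j f x = frechet_derivative f (at x) (axis j 1)"

definition laplacian :: "(real^'n::finite \<Rightarrow> real) \<Rightarrow> real^'n \<Rightarrow> real" where
  "laplacian f x = (\<Sum>j\<in>UNIV. partial j (partial j f) x)"

text \<open>A vector field \<open>X\<close> is given by its coefficient map; as a first order differential
  operator it is \<open>X = \<Sum>\<^sub>j X\<^sub>j \<partial>\<^sub>j\<close>, and its formal adjoint with respect to Lebesgue
  measure is \<open>X\<^sup>\<star> g = - \<Sum>\<^sub>j \<partial>\<^sub>j (X\<^sub>j g)\<close>.\<close>

definition vf_op :: "(real^'n::finite \<Rightarrow> real^'n) \<Rightarrow> (real^'n \<Rightarrow> real) \<Rightarrow> real^'n \<Rightarrow> real" where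
  "vf_op X f x = (\<Sum>j\<in>UNIV. X x $ j * partial j f x)"

definition vf_adjoint :: "(real^'n::finite \<Rightarrow> real^'n) \<Rightarrow> (real^'n \<Rightarrow> real) \<Rightarrow> real^'n \<Rightarrow> real" where
  "vf_adjoint X g x = - (\<Sum>j\<in>UNIV. partial j (\<lambda>y. X y $ j * g y) x)"

text \<open>The coefficient map of the commutator \<open>XY - YX\<close>.\<close>

definition lie_bracket ::
    "(real^'n::finite \<Rightarrow> real^'n) \<Rightarrow> (real^'n \<Rightarrow> real^'n) \<Rightarrow> real^'n \<Rightarrow> real^'n" where
  "lie_bracket X Y x = (\<chi> j. vf_op X (\<lambda>y. Y y $ j) x - vf_op Y (\<lambda>y. X y $ j) x)"

inductive_set Lie :: "(real^'n::finite \<Rightarrow> real^'n) set \<Rightarrow> (real^'n \<Rightarrow> real^'n) set"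
  for G :: "(real^'n \<Rightarrow> real^'n) set" where
  generator: "X \<in> G \<Longrightarrow> X \<in> Lie G"
| zero: "(\<lambda>x. 0) \<in> Lie G"
| add: "X \<in> Lie G \<Longrightarrow> Y \<in> Lie G \<Longrightarrow> (\<lambda>x. X x + Y x) \<in> Lie G"
| scale: "X \<in> Lie G \<Longrightarrow> (\<lambda>x. c *\<^sub>R X x) \<in> Lie G"
| bracket: "X \<in> Lie G \<Longrightarrow> Y \<in> Lie G \<Longrightarrow> lie_bracket X Y \<in> Lie G"

definition hoermander_condition :: "(real^'n::finite \<Rightarrow> real^'n) set \<Rightarrow> bool" where
  "hoermander_condition G \<longleftrightarrow> (\<forall>x. dim ((\<lambda>Y. Y x) ` Lie G) = CARD('n))"

definition sub_laplacian ::
    "nat \<Rightarrow> (nat \<Rightarrow> real^'n::finite \<Rightarrow> real^'n) \<Rightarrow> (real^'n \<Rightarrow> real) \<Rightarrow> real^'n \<Rightarrow> real" where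
  "sub_laplacian m X f x = - (\<Sum>i\<in>{1..m}. vf_adjoint (X i) (vf_op (X i) f) x)"

definition laplacian_outside_compact ::
    "nat \<Rightarrow> (nat \<Rightarrow> real^'n::finite \<Rightarrow> real^'n) \<Rightarrow> bool" where
  "laplacian_outside_compact m X \<longleftrightarrow>
     (\<exists>K. compact K \<and>
       (\<forall>f. smooth_on UNIV f \<longrightarrow> (\<forall>x. x \<notin> K \<longrightarrow> sub_laplacian m X f x = laplacian f x)))"

definition heat_op ::
    "nat \<Rightarrow> (nat \<Rightarrow> real^'n::finite \<Rightarrow> real^'n) \<Rightarrow> ((real^'n) \<times> real \<Rightarrow> real) \<Rightarrow> (real^'n) \<times> real \<Rightarrow> real"
  where
  "heat_op m X u = (\<lambda>(x, t). deriv (\<lambda>s. u (x, s)) t - sub_laplacian m X (\<lambda>w. u (w, t)) x)"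

text \<open>The sub-Laplacian is formally self-adjoint, so the formal adjoint of \<open>\<partial>\<^sub>t - L\<close> is \<open>- \<partial>\<^sub>t - L\<close>.\<close>

definition heat_adjoint ::
    "nat \<Rightarrow> (nat \<Rightarrow> real^'n::finite \<Rightarrow> real^'n) \<Rightarrow> ((real^'n) \<times> real \<Rightarrow> real) \<Rightarrow> (real^'n) \<times> real \<Rightarrow> real"
  where
  "heat_adjoint m X u = (\<lambda>(x, t). - deriv (\<lambda>s. u (x, s)) t - sub_laplacian m X (\<lambda>w. u (w, t)) x)"

definition test_function :: "('a::euclidean_space \<Rightarrow> real) \<Rightarrow> bool" where
  "test_function \<phi> \<longleftrightarrow> smooth_on UNIV \<phi> \<and> compact (closure {w. \<phi> w \<noteq> 0})"

text \<open>\<open>\<Gamma> \<zeta>\<close> is the fundamental solution with pole \<open>\<zeta> = (\<xi>, \<tau>)\<close>: it is locally integrable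
  and applying the heat operator to it in the sense of distributions gives the Dirac
  measure at \<open>\<zeta>\<close>.\<close>

definition heat_fundamental_solution ::
    "nat \<Rightarrow> (nat \<Rightarrow> real^'n::finite \<Rightarrow> real^'n) \<Rightarrow>
     ((real^'n) \<times> real \<Rightarrow> (real^'n) \<times> real \<Rightarrow> real) \<Rightarrow> bool" where
  "heat_fundamental_solution m X \<Gamma> \<longleftrightarrow>
     (\<forall>\<zeta>. (\<forall>K. compact K \<longrightarrow> set_integrable lborel K (\<Gamma> \<zeta>)) \<and>
          (\<forall>\<phi>. test_function \<phi> \<longrightarrow>
             (LINT w|lborel. \<Gamma> \<zeta> w * heat_adjoint m X \<phi> w) = \<phi> \<zeta>))"

text \<open>The function \<open>p\<close> is the time-translation invariant kernel
  \<open>p(x, t; \<xi>, \<tau>) = p(x, \<xi>; t - \<tau>)\<close>. It is a function on all times, because smoothness away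
  from the pole involves times \<open>t \<le> \<tau>\<close>; positivity is required for \<open>t > \<tau>\<close> only, since
  heat kernels vanish for \<open>t < \<tau>\<close>.\<close>

definition positive_heat_kernel ::
    "nat \<Rightarrow> (nat \<Rightarrow> real^'n::finite \<Rightarrow> real^'n) \<Rightarrow> (real^'n \<Rightarrow> real^'n \<Rightarrow> real \<Rightarrow> real) \<Rightarrow> bool"
  where
  "positive_heat_kernel m X p \<longleftrightarrow>
     (let \<Gamma> = (\<lambda>(\<xi>, \<tau>) (x, t). p x \<xi> (t - \<tau>)) in
        heat_fundamental_solution m X \<Gamma> \<and>
        (\<forall>x \<xi> t. t > 0 \<longrightarrow> p x \<xi> t > 0) \<and>
        (\<forall>\<zeta>. smooth_on (- {\<zeta>}) (\<Gamma> \<zeta>)) \<and>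
        (\<forall>\<zeta> w. w \<noteq> \<zeta> \<longrightarrow> heat_op m X (\<Gamma> \<zeta>) w = 0))"

definition bessel_op :: "real \<Rightarrow> (real \<Rightarrow> real) \<Rightarrow> real \<Rightarrow> real" where
  "bessel_op a f z = deriv (deriv f) z + a / z * deriv f z"

definition poisson_kernel ::
    "(real^'n \<Rightarrow> real^'n \<Rightarrow> real \<Rightarrow> real) \<Rightarrow> real \<Rightarrow> real \<Rightarrow>
     real^'n \<Rightarrow> real^'n \<Rightarrow> real \<Rightarrow> real" where
  "poisson_kernel p a z x y t =
     1 / (2 powr (1 - a) * Gamma ((1 - a) / 2)) *
     (z powr (1 - a) / t powr ((3 - a) / 2)) * exp (- (z\<^sup>2 / (4 * t))) * p x y t"

end

theory Submission
  imports Defs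
begin

text \<open>The kernel factors as \<open>K(z,t) p(x,y,t)\<close>. The logarithmic derivative
  \<open>\<partial>\<^sub>t K / K = z\<^sup>2/(4t\<^sup>2) - (3-a)/(2t)\<close> equals \<open>(\<B>\<^sub>a K)/K\<close>, because the terms in \<open>1/z\<^sup>2\<close> produced by
  the factor \<open>z\<^bsup>1-a\<^esup>\<close> cancel. Hence only \<open>K \<partial>\<^sub>t p\<close> survives on the left, and it equals
  \<open>K \<L>\<^sub>x p = \<L>\<^sub>x (K p)\<close>. Homogeneity of \<open>\<L>\<close> needs smoothness of \<open>p\<close>, since
  \<^const>\<open>frechet_derivative\<close> is an arbitrary choice at points of non-differentiability.\<close>

lemma partial_scale:
  assumes "f differentiable (at x)"
  shows "partial j (\<lambda>w. c * f w) x = c * partial j f x"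
proof -
  have "((\<lambda>w. c * f w) has_derivative (\<lambda>h. c * frechet_derivative f (at x) h)) (at x)"
    using assms by (intro has_derivative_mult_right) (simp add: frechet_derivative_works)
  then show ?thesis
    unfolding partial_def by (simp add: frechet_derivative_at [symmetric])
qed

lemma vf_op_scale:
  assumes "f differentiable (at x)"
  shows "vf_op V (\<lambda>w. c * f w) x = c * vf_op V f x"
  using assms by (simp add: vf_op_def partial_scale sum_distrib_left algebra_simps)

lemma differentiable_vec_nth:
  fixes V :: "'a::real_normed_vector \<Rightarrow> real^'n::finite"
  assumes "V differentiable (at x)"
  shows "(\<lambda>w. V w $ j) differentiable (at x)"
  using assms bounded_linear.has_derivative[OF bounded_linear_vec_nth]
  unfolding differentiable_def by blast

lemma vf_adjoint_scale:
  assumes "V differentiable (at x)" and "g differentiable (at x)"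
  shows "vf_adjoint V (\<lambda>w. c * g w) x = c * vf_adjoint V g x"
proof -
  have "partial j (\<lambda>w. c * (V w $ j * g w)) x = c * partial j (\<lambda>w. V w $ j * g w) x" for j
    by (intro partial_scale differentiable_mult differentiable_vec_nth assms)
  then show ?thesis
    by (simp add: vf_adjoint_def sum_distrib_left mult.left_commute)
qed

text \<open>First-order differentiability of \<open>f\<close> is asked at every point because the
  scalar is pulled out of \<open>vf_op (V i)\<close> as an identity of functions, before the adjoint
  differentiates it. The second differentiation happens only at \<open>x\<close>.\<close>

lemma sub_laplacian_scale:
  fixes V :: "nat \<Rightarrow> real^'n::finite \<Rightarrow> real^'n"
  assumes V: "\<And>i. i \<in> {1..m} \<Longrightarrow> V i differentiable (at x)"
    and f: "\<And>w. f differentiable (at w)"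
    and pf: "\<And>j. partial j f differentiable (at x)"
  shows "sub_laplacian m V (\<lambda>w. c * f w) x = c * sub_laplacian m V f x"
proof -
  have "vf_adjoint (V i) (vf_op (V i) (\<lambda>w. c * f w)) x = c * vf_adjoint (V i) (vf_op (V i) f) x"
    if i: "i \<in> {1..m}" for i
  proof -
    have "vf_op (V i) f differentiable (at x)"
      unfolding vf_op_def
      by (intro differentiable_sum differentiable_mult ballI pf differentiable_vec_nth V i) simp
    moreover have "vf_op (V i) (\<lambda>w. c * f w) = (\<lambda>w. c * vf_op (V i) f w)"
      using f by (simp add: vf_op_scale fun_eq_iff)
    ultimately show ?thesis
      using vf_adjoint_scale V i by metis
  qed
  then show ?thesis
    by (simp add: sub_laplacian_def sum_distrib_left)
qed

lemma smooth_on_differentiable: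
  assumes "smooth_on S f" and "x \<in> S"
  shows "f differentiable (at x)"
  using assms unfolding smooth_on_def by (meson Ck_on.simps(2))

lemma smooth_on_frechet_derivative:
  assumes "smooth_on S f"
  shows "smooth_on S (\<lambda>x. frechet_derivative f (at x) v)"
  unfolding smooth_on_def
proof
  fix k
  have "Ck_on (Suc k) S f"
    using assms unfolding smooth_on_def ..
  then show "Ck_on k S (\<lambda>x. frechet_derivative f (at x) v)"
    by simp
qed

text \<open>The heat kernel is smooth jointly in space and time, whereas the sub-Laplacian acts at a
  frozen time. Writing a spatial derivative as a joint derivative in the direction
  \<open>(v, 0)\<close> lets the argument be repeated for second derivatives.\<close>

lemma differentiable_slice_fst:
  assumes "u differentiable (at (x, t))"
  shows "(\<lambda>w. u (w, t)) differentiable (at x)"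
    and "frechet_derivative (\<lambda>w. u (w, t)) (at x) v = frechet_derivative u (at (x, t)) (v, 0)"
proof -
  have "((\<lambda>w. (w, t)) has_derivative (\<lambda>h. (h, 0))) (at x)"
    by (auto intro!: derivative_eq_intros)
  moreover have "(u has_derivative frechet_derivative u (at (x, t))) (at (x, t))"
    using assms by (simp add: frechet_derivative_works)
  ultimately have *: "((\<lambda>w. u (w, t)) has_derivative (\<lambda>h. frechet_derivative u (at (x, t)) (h, 0))) (at x)"
    by (rule has_derivative_compose)
  then show "(\<lambda>w. u (w, t)) differentiable (at x)"
    by (rule differentiableI)
  show "frechet_derivative (\<lambda>w. u (w, t)) (at x) v = frechet_derivative u (at (x, t)) (v, 0)"
    using frechet_derivative_at[OF *] by metis
qed

lemma differentiable_slice_snd: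
  assumes "u differentiable (at (x, t))"
  shows "(\<lambda>s. u (x, s)) differentiable (at t)"
proof -
  have "((\<lambda>s. (x, s)) has_derivative (\<lambda>h. (0, h))) (at t)"
    by (auto intro!: derivative_eq_intros)
  then show ?thesis
    using has_derivative_compose assms unfolding differentiable_def by blast
qed

text \<open>The factor K(z,t) without its Gamma normalisation, which depends on \<open>a\<close>
  alone.\<close>

definition bessel_factor :: "real \<Rightarrow> real \<Rightarrow> real \<Rightarrow> real" where
  "bessel_factor a z t = z powr (1 - a) / t powr ((3 - a) / 2) * exp (- (z\<^sup>2 / (4 * t)))"

lemma bessel_factor_deriv_time:
  assumes "t > 0"
  shows "((\<lambda>s. bessel_factor a z s) has_real_derivative
           (z\<^sup>2 / (4 * t\<^sup>2) - (3 - a) / (2 * t)) * bessel_factor a z t) (at t)"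
proof -
  \<comment> \<open>Valid for every real \<open>s\<close>, so the quotient becomes a product without
    restricting to a neighbourhood of \<open>t\<close>.\<close>
  have eq: "bessel_factor a z = (\<lambda>s. z powr (1 - a) * (s powr (- ((3 - a) / 2)) * exp (- (z\<^sup>2 / (4 * s)))))"
    by (rule ext) (simp only: bessel_factor_def powr_minus divide_inverse mult.assoc)
  have 1: "t powr (- ((3 - a) / 2) - 1) = t powr (- ((3 - a) / 2)) / t"
    using assms by (simp add: powr_diff)
  have "((\<lambda>s. s powr (- ((3 - a) / 2))) has_real_derivative
          - ((3 - a) / 2) * (t powr (- ((3 - a) / 2)) / t)) (at t)"
    using has_real_derivative_powr[OF assms, of "- ((3 - a) / 2)"] by (simp only: 1)
  moreover have "((\<lambda>s. exp (- (z\<^sup>2 / (4 * s)))) has_real_derivative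
          exp (- (z\<^sup>2 / (4 * t))) * (z\<^sup>2 / (4 * t\<^sup>2))) (at t)"
    using assms by (auto intro!: derivative_eq_intros simp: power2_eq_square)
  ultimately show ?thesis
    unfolding eq
    by (rule DERIV_cmult[OF DERIV_mult, THEN DERIV_cong]) (use assms in \<open>simp add: algebra_simps\<close>)
qed

text \<open>The power of z contributes (1-a)/z and the Gaussian -z/(2t). This logarithmic form makes
  the second derivative another product rule.\<close>

lemma bessel_factor_deriv_space:
  assumes "z > 0" and "t > 0"
  shows "((\<lambda>\<zeta>. bessel_factor a \<zeta> t) has_real_derivative
           ((1 - a) / z - z / (2 * t)) * bessel_factor a z t) (at z)"
proof -
  have eq: "bessel_factor a \<zeta> t =
      inverse (t powr ((3 - a) / 2)) * (\<zeta> powr (1 - a) * exp (- (\<zeta>\<^sup>2 / (4 * t))))" for \<zeta>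
    by (simp only: bessel_factor_def divide_inverse mult_ac)
  have 1: "z powr (1 - a - 1) = z powr (1 - a) / z"
    using assms powr_diff[of z "1 - a" 1] by simp
  have "((\<lambda>\<zeta>. \<zeta> powr (1 - a)) has_real_derivative (1 - a) * (z powr (1 - a) / z)) (at z)"
    using has_real_derivative_powr[OF assms(1), of "1 - a"] by (simp only: 1)
  moreover have "((\<lambda>\<zeta>. exp (- (\<zeta>\<^sup>2 / (4 * t)))) has_real_derivative
          exp (- (z\<^sup>2 / (4 * t))) * (- z / (2 * t))) (at z)"
    using assms by (auto intro!: derivative_eq_intros)
  ultimately show ?thesis
    unfolding eq
    by (rule DERIV_cmult[OF DERIV_mult, THEN DERIV_cong]) (simp add: algebra_simps)
qed

text \<open>If f' = q f, then f'' = (q' + q^2) f, so the Bessel operator multiplies f by q' + q^2 +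
  (a/z) q. The constant \<open>c\<close> will absorb the normalisation and \<open>p x y t\<close>,
  which do not involve z.\<close>

lemma bessel_op_bessel_factor:
  assumes z: "z > 0" and t: "t > 0"
  shows "bessel_op a (\<lambda>\<zeta>. c * bessel_factor a \<zeta> t) z =
           c * ((z\<^sup>2 / (4 * t\<^sup>2) - (3 - a) / (2 * t)) * bessel_factor a z t)"
proof -
  define f where "f = (\<lambda>\<zeta>. c * bessel_factor a \<zeta> t)"
  define q where "q = (\<lambda>\<zeta>. (1 - a) / \<zeta> - \<zeta> / (2 * t))"
  have f1: "(f has_real_derivative q \<zeta> * f \<zeta>) (at \<zeta>)" if "\<zeta> > 0" for \<zeta>
    unfolding f_def q_def
    by (rule DERIV_cmult[OF bessel_factor_deriv_space, THEN DERIV_cong]) (use that t in auto)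
  have "(q has_real_derivative - (1 - a) / z\<^sup>2 - 1 / (2 * t)) (at z)"
    unfolding q_def using z t by (auto intro!: derivative_eq_intros simp: power2_eq_square)
  then have "((\<lambda>\<zeta>. q \<zeta> * f \<zeta>) has_real_derivative
      (- (1 - a) / z\<^sup>2 - 1 / (2 * t)) * f z + (q z * f z) * q z) (at z)"
    using f1[OF z] by (rule DERIV_mult)
  then have "(deriv f has_real_derivative
      (- (1 - a) / z\<^sup>2 - 1 / (2 * t)) * f z + (q z * f z) * q z) (at z)"
    \<comment> \<open>The formula for \<open>deriv f\<close> is known only on the open half-line,
      which suffices for differentiating it at \<open>z\<close>.\<close>
    by (rule has_field_derivative_transform_within_open[where S = "{0<..}"])
       (use z f1[THEN DERIV_imp_deriv] in auto)
  then have "bessel_op a f z =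
      (- (1 - a) / z\<^sup>2 - 1 / (2 * t) + (q z)\<^sup>2 + a / z * q z) * f z"
    using DERIV_imp_deriv[OF f1[OF z]]
    by (simp add: bessel_op_def DERIV_imp_deriv power2_eq_square algebra_simps)
  \<comment> \<open>The coefficient of 1/z^2 is (1-a)(-1 + (1-a) + a) = 0, and that of 1/(2t) is -1
    - 2(1-a) - a = -(3-a).\<close>
  also have "- (1 - a) / z\<^sup>2 - 1 / (2 * t) + (q z)\<^sup>2 + a / z * q z = z\<^sup>2 / (4 * t\<^sup>2) - (3 - a) / (2 * t)"
    unfolding q_def using z t by (simp add: field_simps power2_eq_square)
  finally show ?thesis
    by (simp add: f_def)
qed

theorem proposition9p6:
  fixes X :: "nat \<Rightarrow> real^'n::finite \<Rightarrow> real^'n" and m :: nat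
    and p :: "real^'n \<Rightarrow> real^'n \<Rightarrow> real \<Rightarrow> real"
    and a z t :: real and x y :: "real^'n"
  assumes "CARD('n) \<ge> 3"
    and "\<And>i. i \<in> {1..m} \<Longrightarrow> smooth_on UNIV (X i)"
    and "hoermander_condition (X ` {1..m})"
    and "laplacian_outside_compact m X"
    and "positive_heat_kernel m X p"
    and "- 1 < a" and "a < 1"
    and "x \<noteq> y" and "t > 0" and "z > 0"
  shows "deriv (\<lambda>s. poisson_kernel p a z x y s) t - bessel_op a (\<lambda>\<zeta>. poisson_kernel p a \<zeta> x y t) z
       = sub_laplacian m X (\<lambda>w. poisson_kernel p a z w y t) x"
proof -
  define C where "C = 1 / (2 powr (1 - a) * Gamma ((1 - a) / 2))"
  define u where "u = (\<lambda>(w, s). p w y s)"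
  define K where "K = bessel_factor a z t"
  define l where "l = z\<^sup>2 / (4 * t\<^sup>2) - (3 - a) / (2 * t)"
  have P: "poisson_kernel p a \<zeta> w y s = C * bessel_factor a \<zeta> s * p w y s" for \<zeta> w s
    by (simp add: poisson_kernel_def C_def bessel_factor_def)
  \<comment> \<open>The pole is placed at \<open>(y, 0)\<close>, so that the time shift
    disappears.\<close>
  have u: "u = (\<lambda>(\<xi>, \<tau>) (x, t). p x \<xi> (t - \<tau>)) (y, 0)"
    by (simp add: u_def)
  have smooth: "smooth_on (- {(y, 0)}) u"
    and heat: "\<And>w. w \<noteq> (y, 0) \<Longrightarrow> heat_op m X u w = 0"
    using assms(5) unfolding positive_heat_kernel_def Let_def u by blast+
  \<comment> \<open>The whole time slice avoids the pole, which gives differentiability in space at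
    every \<open>w\<close>, as \<open>sub_laplacian_scale\<close> requires.\<close>
  have off_pole: "(w, t) \<in> - {(y, 0)}" for w
    using \<open>t > 0\<close> by simp
  note u_diff = smooth_on_differentiable[OF smooth off_pole]
  have p_diff: "(\<lambda>w. p w y t) differentiable (at w)" for w
    using differentiable_slice_fst(1)[OF u_diff] by (simp add: u_def)
  \<comment> \<open>Each spatial partial is a slice of a directional derivative of \<open>u\<close>,
    which is again smooth off the pole and can be differentiated once more.\<close>
  have "partial j (\<lambda>w. p w y t) = (\<lambda>w. frechet_derivative u (at (w, t)) (axis j 1, 0))" for j
    using differentiable_slice_fst(2)[OF u_diff] by (simp add: u_def partial_def fun_eq_iff)
  then have partial_diff: "partial j (\<lambda>w. p w y t) differentiable (at x)" for j
    using differentiable_slice_fst(1)[OF smooth_on_differentiable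
        [OF smooth_on_frechet_derivative[OF smooth] off_pole]] by simp
  have X_diff: "X i differentiable (at x)" if "i \<in> {1..m}" for i
    using smooth_on_differentiable assms(2)[OF that] by blast
  have "(\<lambda>s. p x y s) differentiable (at t)"
    using differentiable_slice_snd[OF u_diff] by (simp add: u_def)
  then have p_time: "((\<lambda>s. p x y s) has_real_derivative deriv (p x y) t) (at t)"
    by (simp add: DERIV_deriv_iff_real_differentiable)
  have "deriv (\<lambda>s. poisson_kernel p a z x y s) t = C * (l * K) * p x y t + deriv (p x y) t * (C * K)"
    unfolding P K_def l_def
    by (intro DERIV_imp_deriv DERIV_mult DERIV_cmult bessel_factor_deriv_time p_time assms)
  moreover have "bessel_op a (\<lambda>\<zeta>. poisson_kernel p a \<zeta> x y t) z = C * (l * K) * p x y t"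
    using bessel_op_bessel_factor[OF \<open>z > 0\<close> \<open>t > 0\<close>, of a "C * p x y t"]
    by (simp add: P K_def l_def mult_ac)
  moreover have "sub_laplacian m X (\<lambda>w. poisson_kernel p a z w y t) x
      = C * K * sub_laplacian m X (\<lambda>w. p w y t) x"
    unfolding P K_def by (rule sub_laplacian_scale[OF X_diff p_diff partial_diff])
  moreover have "deriv (p x y) t = sub_laplacian m X (\<lambda>w. p w y t) x"
    using heat[of "(x, t)"] \<open>t > 0\<close> by (simp add: heat_op_def u_def)
  ultimately show ?thesis
    by simp
qed

end
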